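(* Let $f:\mathbb{R}^2\to\mathbb{R}$ be a polynomial function of degree $d\ge2$. Assume that the fibre $F_+$ contains a compact connected component $C$. Then $F_+=C$ and $F_-$ is empty, and moreover all the non-empty fibres of $f$ are compact. The same statement holds if we switch the roles of $F_-$ and $F_+$.
   Context: The set $\operatorname{Atyp} f\subset\mathbb{R}$ of atypical values of $f$ is the minimal subset which contains the critical values $f(\operatorname{Sing} f)$ and such that $f$ is a locally trivial $C^\infty$-fibration over $\mathbb{R}\setminus\operatorname{Atyp} f$. It is a finite set. Let $I_+$ (resp. $I_-$) be the unbounded interval of $\mathbb{R}\setminus\operatorname{Atyp} f$ towards $+\infty$ (resp. $-\infty$); they are both equal to $\mathbb{R}$ if $\operatorname{Atyp} f=\emptyset$. The restriction of $f$ over $I_+$, resp. $I_-$, is a trivial fibration. $F_+$ (resp. $F_-$) denotes the fibre of $f$ over some point of $I_+$ (resp. $I_-$). *)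

theory Defs
  imports "HOL-Analysis.Analysis"
begin

text \<open>A polynomial function on the plane of total degree exactly \<open>d\<close>.\<close>

definition polynomial_of_degree :: "nat \<Rightarrow> (real \<times> real \<Rightarrow> real) \<Rightarrow> bool" where
  "polynomial_of_degree d f \<longleftrightarrow>
    (\<exists>a :: nat \<Rightarrow> nat \<Rightarrow> real.
      (\<forall>x y. f (x, y) = (\<Sum>i\<le>d. \<Sum>j\<le>d - i. a i j * x ^ i * y ^ j)) \<and>
      (\<exists>i\<le>d. a i (d - i) \<noteq> 0))"

text \<open>\<open>Ck_on k f U\<close> is meant for open \<open>U\<close>: all iterated directional derivatives of \<open>f\<close> up to
  order \<open>k\<close> exist and are continuous on \<open>U\<close>.\<close>

fun Ck_on :: "nat \<Rightarrow> ('a::euclidean_space \<Rightarrow> 'b::euclidean_space) \<Rightarrow> 'a set \<Rightarrow> bool" where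
  "Ck_on 0 f U \<longleftrightarrow> continuous_on U f"
| "Ck_on (Suc k) f U \<longleftrightarrow>
    (\<forall>x\<in>U. f differentiable (at x)) \<and> (\<forall>v. Ck_on k (\<lambda>x. frechet_derivative f (at x) v) U)"

text \<open>Smoothness on an arbitrary subset of a Euclidean space: locally the restriction of a
  \<open>C\<^sup>\<infinity>\<close> map defined on an open set. On an embedded submanifold, such as the fibre of \<open>f\<close> over a
  regular value, this is smoothness in the sense of manifolds.\<close>

definition smooth_map :: "'a::euclidean_space set \<Rightarrow> ('a \<Rightarrow> 'b::euclidean_space) \<Rightarrow> bool" where
  "smooth_map S f \<longleftrightarrow>
    (\<forall>x\<in>S. \<exists>U g. open U \<and> x \<in> U \<and> (\<forall>k. Ck_on k g U) \<and> (\<forall>y\<in>S \<inter> U. g y = f y))"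

definition diffeomorphism ::
  "'a::euclidean_space set \<Rightarrow> 'b::euclidean_space set \<Rightarrow> ('a \<Rightarrow> 'b) \<Rightarrow> bool" where
  "diffeomorphism S T h \<longleftrightarrow> (\<exists>k. homeomorphism S T h k \<and> smooth_map S h \<and> smooth_map T k)"

definition Sing :: "('a::euclidean_space \<Rightarrow> real) \<Rightarrow> 'a set" where
  "Sing f = {p. (f has_derivative (\<lambda>_. 0)) (at p)}"

text \<open>The restriction of \<open>f\<close> over \<open>B\<close> is a locally trivial \<open>C\<^sup>\<infinity>\<close> fibration; fibres may be empty.
  It is used below only for \<open>B\<close> free of critical values, so that the model fibre
  \<open>f -` {t}\<close> is a submanifold.\<close>

definition locally_trivial_fibration_over ::
  "real set \<Rightarrow> ('a::euclidean_space \<Rightarrow> real) \<Rightarrow> bool" where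
  "locally_trivial_fibration_over B f \<longleftrightarrow>
    (\<forall>t\<in>B. \<exists>D h. open D \<and> t \<in> D \<and> D \<subseteq> B \<and>
      diffeomorphism (f -` D) ((f -` {t}) \<times> D) h \<and>
      (\<forall>p\<in>f -` D. snd (h p) = f p))"

definition Atyp :: "('a::euclidean_space \<Rightarrow> real) \<Rightarrow> real set" where
  "Atyp f = \<Inter>{A. f ` Sing f \<subseteq> A \<and> locally_trivial_fibration_over (- A) f}"

text \<open>The intersection defining \<open>Atyp\<close> is itself a member of the family, hence its minimum.\<close>

lemma Sing_values_subset_Atyp: "f ` Sing f \<subseteq> Atyp f"
  unfolding Atyp_def by blast

lemma locally_trivial_fibration_over_Atyp: "locally_trivial_fibration_over (- Atyp f) f"
  unfolding locally_trivial_fibration_over_def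
proof
  fix t assume "t \<in> - Atyp f"
  then obtain A where A: "f ` Sing f \<subseteq> A" "locally_trivial_fibration_over (- A) f" "t \<in> - A"
    unfolding Atyp_def by auto
  have "- A \<subseteq> - Atyp f"
    using A unfolding Atyp_def by auto
  then show "\<exists>D h. open D \<and> t \<in> D \<and> D \<subseteq> - Atyp f \<and>
      diffeomorphism (f -` D) ((f -` {t}) \<times> D) h \<and> (\<forall>p\<in>f -` D. snd (h p) = f p)"
    using A(2,3) unfolding locally_trivial_fibration_over_def by (meson subset_trans)
qed

lemma Atyp_least:
  assumes "f ` Sing f \<subseteq> A" "locally_trivial_fibration_over (- A) f"
  shows "Atyp f \<subseteq> A"
  using assms unfolding Atyp_def by blast

text \<open>The unbounded intervals of \<open>- Atyp f\<close> towards \<open>+\<infinity>\<close> and \<open>-\<infinity>\<close>.\<close>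

definition I_plus :: "('a::euclidean_space \<Rightarrow> real) \<Rightarrow> real set" where
  "I_plus f = {t. {t..} \<subseteq> - Atyp f}"

definition I_minus :: "('a::euclidean_space \<Rightarrow> real) \<Rightarrow> real set" where
  "I_minus f = {t. {..t} \<subseteq> - Atyp f}"

end

theory Submission
  imports Defs
begin

text \<open>
  The idea is to carry a compact part of a fibre along growing values of \<open>f\<close>. Let \<open>A\<close> be a
  non-empty compact part of the fibre over \<open>t \<in> I_plus f\<close> that is also open in that fibre. As \<open>f\<close> is locally trivial over \<open>{t..}\<close>, the set
  \<open>A\<close> can be carried along all larger values; it sweeps out a closed set \<open>K\<close> that is open in
  \<open>f -` {t..}\<close>, meets every \<open>f -` {..s}\<close> in a compact set, and on which \<open>f\<close> takes all values
  \<open>\<ge> t\<close> (lemma \<open>tube_over_half_line\<close>). Hence \<open>K\<close> is unbounded, and its boundary points all lie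
  in \<open>A\<close>, which is bounded. Since the complement of a large ball in the plane is connected, \<open>K\<close>
  contains that complement: this is where the dimension of the source enters.

  Everything follows from this. Sublevel sets of \<open>f\<close> are compact, because outside of a ball they lie
  in \<open>K\<close>; so all fibres are compact and \<open>f\<close> has a minimum. The rest \<open>f -` {t..} - K\<close> is compact, so
  if it were non-empty then \<open>f\<close> would have a maximum on it, but local triviality always allows moving
  to larger values. Hence \<open>A\<close> is the whole fibre. By the Sura-Bura theorem a compact component \<open>C\<close> is
  the intersection of all such sets \<open>A\<close> that contain it, so \<open>C\<close> is the whole fibre. Finally the minimum of \<open>f\<close> is an
  atypical value, again because over other values one can move to smaller ones; so it lies
  above \<open>I_minus f\<close>, and the fibres over \<open>I_minus f\<close> are empty. The other half is the same argument
  for \<open>-f\<close>.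
\<close>

section \<open>Parallel transport\<close>

text \<open>Topological local triviality of \<open>f\<close> near the value \<open>x\<close>, without a model fibre: \<open>\<tau> p r\<close>
  is the point of the fibre over \<open>r\<close> in the same horizontal leaf as \<open>p\<close>. Unlike a
  trivialisation, this form is unchanged when the base point \<open>x\<close> moves in \<open>D\<close>, and it passes to \<open>-f\<close> by
  a change of sign.\<close>

definition transport_near :: "('a::topological_space \<Rightarrow> real) \<Rightarrow> real \<Rightarrow> bool" where
  "transport_near f x \<longleftrightarrow> (\<exists>D \<tau>. open D \<and> x \<in> D \<and>
     continuous_on ((f -` D) \<times> D) (\<lambda>(p, r). \<tau> p r) \<and>
     (\<forall>p\<in>f -` D. \<tau> p (f p) = p) \<and>
     (\<forall>p\<in>f -` D. \<forall>r\<in>D. f (\<tau> p r) = r) \<and>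
     (\<forall>p\<in>f -` D. \<forall>r\<in>D. \<forall>r'\<in>D. \<tau> (\<tau> p r) r' = \<tau> p r'))"

lemma transport_nearE:
  assumes "transport_near f x"
  obtains D \<tau> where "open D" "x \<in> D" "continuous_on ((f -` D) \<times> D) (\<lambda>(p, r). \<tau> p r)"
    "\<And>p. f p \<in> D \<Longrightarrow> \<tau> p (f p) = p"
    "\<And>p r. f p \<in> D \<Longrightarrow> r \<in> D \<Longrightarrow> f (\<tau> p r) = r"
    "\<And>p r r'. f p \<in> D \<Longrightarrow> r \<in> D \<Longrightarrow> r' \<in> D \<Longrightarrow> \<tau> (\<tau> p r) r' = \<tau> p r'"
  using assms unfolding transport_near_def by auto

lemma transport_near_typical_value:
  assumes "x \<notin> Atyp f"
  shows "transport_near f x"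
proof -
  obtain D h where D: "open D" "x \<in> D" "diffeomorphism (f -` D) ((f -` {x}) \<times> D) h"
    and snd_h: "\<And>p. f p \<in> D \<Longrightarrow> snd (h p) = f p"
    using locally_trivial_fibration_over_Atyp[of f] assms
    unfolding locally_trivial_fibration_over_def by (metis ComplI vimageI)
  then obtain k where hom: "homeomorphism (f -` D) ((f -` {x}) \<times> D) h k"
    unfolding diffeomorphism_def by blast
  have kh: "k (h p) = p" if "f p \<in> D" for p
    using homeomorphism_apply1[OF hom] that by simp
  have hk: "h (k y) = y" if "y \<in> (f -` {x}) \<times> D" for y
    using homeomorphism_apply2[OF hom that] .
  have h_in: "h p \<in> (f -` {x}) \<times> D" if "f p \<in> D" for p
    using homeomorphism_image1[OF hom] that by blast
  have k_in: "f (k y) \<in> D" if "y \<in> (f -` {x}) \<times> D" for y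
    using homeomorphism_image2[OF hom] that by blast
  define \<tau> where "\<tau> p r = k (fst (h p), r)" for p r
  have pair_in: "(fst (h p), r) \<in> (f -` {x}) \<times> D" if "f p \<in> D" "r \<in> D" for p r
    using h_in[OF that(1)] that(2) by (auto simp: mem_Times_iff)
  have h_\<tau>: "h (\<tau> p r) = (fst (h p), r)" if "f p \<in> D" "r \<in> D" for p r
    unfolding \<tau>_def by (rule hk[OF pair_in[OF that]])
  have f_\<tau>: "f (\<tau> p r) = r" if "f p \<in> D" "r \<in> D" for p r
    using snd_h[of "\<tau> p r"] h_\<tau>[OF that] k_in[OF pair_in[OF that]] by (simp add: \<tau>_def)
  have self: "\<tau> p (f p) = p" if "f p \<in> D" for p
    using kh[OF that] snd_h[OF that] by (metis \<tau>_def prod.collapse)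
  have comp: "\<tau> (\<tau> p r) r' = \<tau> p r'" if "f p \<in> D" "r \<in> D" for p r r'
    using h_\<tau>[OF that] unfolding \<tau>_def by simp
  have "continuous_on ((f -` D) \<times> D) (\<lambda>z. k (fst (h (fst z)), snd z))"
  proof (rule continuous_on_compose2[OF homeomorphism_cont2[OF hom]])
    show "continuous_on ((f -` D) \<times> D) (\<lambda>z. (fst (h (fst z)), snd z))"
      by (intro continuous_intros continuous_on_compose2[OF homeomorphism_cont1[OF hom]]) auto
    show "(\<lambda>z. (fst (h (fst z)), snd z)) ` ((f -` D) \<times> D) \<subseteq> (f -` {x}) \<times> D"
      using pair_in by fastforce
  qed
  then have "continuous_on ((f -` D) \<times> D) (\<lambda>(p, r). \<tau> p r)"
    by (simp add: \<tau>_def case_prod_unfold)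
  then show ?thesis
    unfolding transport_near_def using D f_\<tau> self comp
    by (intro exI[of _ D] exI[of _ \<tau>]) auto
qed

lemma transport_near_uminus:
  assumes "transport_near f x"
  shows "transport_near (\<lambda>p. - f p) (- x)"
proof -
  obtain D \<tau> where D: "open D" "x \<in> D" "continuous_on ((f -` D) \<times> D) (\<lambda>(p, r). \<tau> p r)"
    "\<And>p. f p \<in> D \<Longrightarrow> \<tau> p (f p) = p"
    "\<And>p r. f p \<in> D \<Longrightarrow> r \<in> D \<Longrightarrow> f (\<tau> p r) = r"
    "\<And>p r r'. f p \<in> D \<Longrightarrow> r \<in> D \<Longrightarrow> r' \<in> D \<Longrightarrow> \<tau> (\<tau> p r) r' = \<tau> p r'"
    using assms by (rule transport_nearE) blast
  have "continuous_on (((\<lambda>p. - f p) -` uminus ` D) \<times> uminus ` D) (\<lambda>z. (\<lambda>(p, r). \<tau> p r) (fst z, - snd z))"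
    by (rule continuous_on_compose2[OF D(3)]) (auto intro!: continuous_intros)
  then show ?thesis
    unfolding transport_near_def
    by (intro exI[of _ "uminus ` D"] exI[of _ "\<lambda>p r. \<tau> p (- r)"])
      (use D in \<open>auto simp: open_negations case_prod_unfold\<close>)
qed

text \<open>The path \<open>\<tau> q\<close> starts at \<open>q\<close> and raises the value of \<open>f\<close>, so \<open>f\<close> has no local maximum over a value
  with transport. Applied to \<open>-f\<close>, this excludes minima.\<close>

lemma transport_near_imp_larger_value:
  assumes "transport_near f (f q)" "open O'" "q \<in> O'"
  shows "\<exists>p\<in>O'. f p > f q"
proof -
  obtain D \<tau> where D: "open D" "f q \<in> D" "continuous_on ((f -` D) \<times> D) (\<lambda>(p, r). \<tau> p r)"
    "\<And>p. f p \<in> D \<Longrightarrow> \<tau> p (f p) = p"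
    "\<And>p r. f p \<in> D \<Longrightarrow> r \<in> D \<Longrightarrow> f (\<tau> p r) = r"
    using assms(1) by (rule transport_nearE) blast
  have "continuous_on D (\<lambda>r. (\<lambda>(p, r). \<tau> p r) (q, r))"
    by (rule continuous_on_compose2[OF D(3)]) (use D(2) in \<open>auto intro!: continuous_intros\<close>)
  then have "continuous_on D (\<tau> q)"
    by simp
  then have "open (D \<inter> \<tau> q -` O')"
    using assms(2) D(1) by (simp add: continuous_on_open_vimage Int_commute)
  moreover have "f q \<in> D \<inter> \<tau> q -` O'"
    using D assms(3) by simp
  ultimately obtain e where "e > 0" "cball (f q) e \<subseteq> D \<inter> \<tau> q -` O'"
    by (meson open_contains_cball)
  moreover have "f q + e \<in> cball (f q) e"
    using \<open>e > 0\<close> by (simp add: dist_real_def)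
  ultimately have "f q + e \<in> D \<inter> \<tau> q -` O'"
    by blast
  then show ?thesis
    using D(5)[OF D(2)] \<open>e > 0\<close> by (intro bexI[of _ "\<tau> q (f q + e)"]) auto
qed

section \<open>Tubes of compact fibre parts\<close>

text \<open>The condition \<open>f ` K = J\<close> says that no fibre of the tube is empty. A tube over \<open>{a}\<close> is a non-empty
  compact open part of the fibre over \<open>a\<close>.\<close>

definition tube :: "('a::topological_space \<Rightarrow> real) \<Rightarrow> real set \<Rightarrow> 'a set \<Rightarrow> bool" where
  "tube f J K \<longleftrightarrow> compact K \<and> openin (top_of_set (f -` J)) K \<and> f ` K = J"

definition tubes_extend :: "('a::topological_space \<Rightarrow> real) \<Rightarrow> real \<Rightarrow> real \<Rightarrow> bool" where
  "tubes_extend f a b \<longleftrightarrow> (\<forall>A. tube f {a} A \<longrightarrow> (\<exists>K. tube f {a..b} K \<and> K \<inter> f -` {a} = A))"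

text \<open>Transport to the fibre over \<open>a\<close> is a retraction of \<open>f -` {a..b}\<close>; the preimage of \<open>A\<close> under it is
  open, and is compact as the image of \<open>A \<times> {a..b}\<close> under transport.\<close>

lemma tubes_extend_locally:
  fixes f :: "'a::t2_space \<Rightarrow> real"
  assumes "transport_near f x"
  shows "\<exists>d>0. \<forall>a b. a \<le> x \<and> x \<le> b \<and> b - a < d \<longrightarrow> tubes_extend f a b"
proof -
  obtain D \<tau> where D: "open D" "x \<in> D" "continuous_on ((f -` D) \<times> D) (\<lambda>(p, r). \<tau> p r)"
    "\<And>p. f p \<in> D \<Longrightarrow> \<tau> p (f p) = p"
    "\<And>p r. f p \<in> D \<Longrightarrow> r \<in> D \<Longrightarrow> f (\<tau> p r) = r"
    "\<And>p r r'. f p \<in> D \<Longrightarrow> r \<in> D \<Longrightarrow> r' \<in> D \<Longrightarrow> \<tau> (\<tau> p r) r' = \<tau> p r'"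
    using assms by (rule transport_nearE) blast
  obtain d where d: "d > 0" "ball x d \<subseteq> D"
    using D(1,2) by (meson open_contains_ball)
  have "tubes_extend f a b" if ab: "a \<le> x" "x \<le> b" "b - a < d" for a b
    unfolding tubes_extend_def
  proof (intro allI impI)
    fix A assume A: "tube f {a} A"
    have J: "{a..b} \<subseteq> D"
      using ab d(2) by (auto simp: subset_iff dist_real_def)
    have aJ: "a \<in> {a..b}" "a \<in> D"
      using ab J by auto
    have A_a: "f p = a" if "p \<in> A" for p
      using A that unfolding tube_def by auto
    define K where "K = f -` {a..b} \<inter> (\<lambda>p. \<tau> p a) -` A"
    have "continuous_on (f -` {a..b}) (\<lambda>p. (\<lambda>(p, r). \<tau> p r) (p, a))"
      by (rule continuous_on_compose2[OF D(3)]) (use J aJ in \<open>auto intro!: continuous_intros\<close>)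
    then have retr: "continuous_on (f -` {a..b}) (\<lambda>p. \<tau> p a)"
      by simp
    have "openin (top_of_set (f -` {a..b})) K"
      unfolding K_def
    proof (rule continuous_openin_preimage[OF retr])
      show "(\<lambda>p. \<tau> p a) \<in> f -` {a..b} \<rightarrow> f -` {a}"
        using D(5) J aJ by (auto simp: subset_iff)
      show "openin (top_of_set (f -` {a})) A"
        using A unfolding tube_def by blast
    qed
    moreover have K_image: "K = (\<lambda>(p, r). \<tau> p r) ` (A \<times> {a..b})"
    proof (intro equalityI subsetI)
      fix p assume p: "p \<in> K"
      then have "f p \<in> {a..b}" "\<tau> p a \<in> A"
        unfolding K_def by auto
      moreover from this have "\<tau> (\<tau> p a) (f p) = p"
        using D(4,6) J aJ by (metis subsetD)
      ultimately show "p \<in> (\<lambda>(p, r). \<tau> p r) ` (A \<times> {a..b})"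
        by (intro image_eqI[of _ _ "(\<tau> p a, f p)"]) auto
    next
      fix p assume "p \<in> (\<lambda>(p, r). \<tau> p r) ` (A \<times> {a..b})"
      then obtain q r where qr: "q \<in> A" "r \<in> {a..b}" "p = \<tau> q r"
        by auto
      then have q: "f q = a" "f q \<in> D" "r \<in> D"
        using A_a J aJ by auto
      have "f p = r" "\<tau> p a = q"
        using D(4)[of q] D(5)[of q r] D(6)[of q r a] q qr(3) aJ by auto
      then show "p \<in> K"
        unfolding K_def using qr by simp
    qed
    moreover have "compact K"
      unfolding K_image
    proof (rule compact_continuous_image)
      show "continuous_on (A \<times> {a..b}) (\<lambda>(p, r). \<tau> p r)"
        using A_a J aJ by (intro continuous_on_subset[OF D(3)]) auto
      show "compact (A \<times> {a..b})"
        using A unfolding tube_def by (auto intro: compact_Times)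
    qed
    moreover have "f ` K = {a..b}"
    proof
      show "f ` K \<subseteq> {a..b}"
        unfolding K_def by auto
      obtain q where q: "q \<in> A"
        using A unfolding tube_def by blast
      show "{a..b} \<subseteq> f ` K"
      proof
        fix r assume r: "r \<in> {a..b}"
        then have "\<tau> q r \<in> K"
          unfolding K_image using q by auto
        moreover have "f (\<tau> q r) = r"
          using D(5)[of q r] A_a[OF q] r J aJ by auto
        ultimately show "r \<in> f ` K"
          by force
      qed
    qed
    moreover have "K \<inter> f -` {a} = A"
    proof (intro set_eqI)
      fix p
      show "p \<in> K \<inter> f -` {a} \<longleftrightarrow> p \<in> A"
        using D(4)[of p] A_a[of p] aJ unfolding K_def by auto
    qed
    ultimately show "\<exists>K. tube f {a..b} K \<and> K \<inter> f -` {a} = A"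
      unfolding tube_def by blast
  qed
  then show ?thesis
    using d(1) by blast
qed

lemma tube_fibre:
  fixes f :: "'a::t2_space \<Rightarrow> real"
  assumes "continuous_on UNIV f" "tube f J K" "x \<in> J"
  shows "tube f {x} (K \<inter> f -` {x})"
proof -
  have cl: "closed (f -` {x})"
    using assms(1) by (simp add: closed_vimage)
  have "openin (top_of_set (f -` {x})) (f -` {x} \<inter> K)"
    using assms(2,3) unfolding tube_def
    by (auto simp: openin_open)
  moreover have "x \<in> f ` (K \<inter> f -` {x})"
    using assms(2,3) unfolding tube_def by force
  ultimately show ?thesis
    using assms(2) cl unfolding tube_def by (auto simp: compact_Int_closed Int_commute)
qed

text \<open>Two tubes with the same fibre over \<open>b\<close> can be glued: a set is open in \<open>f -` {a..c}\<close> if its complement is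
  closed, and the complement of the union is the union of the two complements.\<close>

lemma tube_union:
  fixes f :: "'a::t2_space \<Rightarrow> real"
  assumes f: "continuous_on UNIV f" and "a \<le> b" "b \<le> c"
    and K: "tube f {a..b} K" and L: "tube f {b..c} L"
    and eq: "L \<inter> f -` {b} = K \<inter> f -` {b}"
  shows "tube f {a..c} (K \<union> L)" "(K \<union> L) \<inter> f -` {a..b} = K"
proof -
  have ivl: "{a..b} \<union> {b..c} = {a..c}"
    using assms(2,3) by auto
  have K_le: "f p \<in> {a..b}" if "p \<in> K" for p
    using K that unfolding tube_def by blast
  have L_ge: "f p \<in> {b..c}" if "p \<in> L" for p
    using L that unfolding tube_def by blast
  have only_b: "p \<in> K \<longleftrightarrow> p \<in> L" if "f p = b" for p
    using eq that by blast
  have cl: "closed (f -` {a..b})" "closed (f -` {b..c})"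
    using f by (auto intro: closed_vimage)
  have "closedin (top_of_set (f -` {a..b})) (f -` {a..b} - K)"
    "closedin (top_of_set (f -` {b..c})) (f -` {b..c} - L)"
    using K L unfolding tube_def by (auto intro!: closedin_diff)
  then have "closed ((f -` {a..b} - K) \<union> (f -` {b..c} - L))"
    using cl by (metis closed_Un closedin_closed_trans)
  moreover have "f -` {a..c} - (K \<union> L) = (f -` {a..b} - K) \<union> (f -` {b..c} - L)"
  proof (intro set_eqI)
    fix p
    show "p \<in> f -` {a..c} - (K \<union> L) \<longleftrightarrow> p \<in> (f -` {a..b} - K) \<union> (f -` {b..c} - L)"
      using K_le[of p] L_ge[of p] only_b[of p] assms(2,3)
      by (cases "f p < b"; cases "f p = b") auto
  qed
  ultimately have "closedin (top_of_set (f -` {a..c})) (f -` {a..c} - (K \<union> L))"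
    by (metis closed_subset Diff_subset)
  moreover have sub: "K \<union> L \<subseteq> f -` {a..c}"
    using K_le L_ge assms(2,3) by fastforce
  ultimately have "openin (top_of_set (f -` {a..c})) (K \<union> L)"
    by (simp add: openin_closedin_eq)
  then show "tube f {a..c} (K \<union> L)"
    using K L ivl unfolding tube_def by (auto simp: image_Un compact_Un)
  show "(K \<union> L) \<inter> f -` {a..b} = K"
  proof (intro set_eqI)
    fix p
    show "p \<in> (K \<union> L) \<inter> f -` {a..b} \<longleftrightarrow> p \<in> K"
      using K_le[of p] L_ge[of p] only_b[of p] by auto
  qed
qed

lemma tubes_extend_trans:
  fixes f :: "'a::t2_space \<Rightarrow> real"
  assumes f: "continuous_on UNIV f" and "a \<le> b" "b \<le> c"
    and "tubes_extend f a b" "tubes_extend f b c"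
  shows "tubes_extend f a c"
  unfolding tubes_extend_def
proof (intro allI impI)
  fix A assume "tube f {a} A"
  then obtain K where K: "tube f {a..b} K" "K \<inter> f -` {a} = A"
    using assms(4) unfolding tubes_extend_def by blast
  then have "tube f {b} (K \<inter> f -` {b})"
    using assms(2) by (intro tube_fibre[OF f K(1)]) auto
  then obtain L where L: "tube f {b..c} L" "L \<inter> f -` {b} = K \<inter> f -` {b}"
    using assms(5) unfolding tubes_extend_def by blast
  note un = tube_union[OF f assms(2,3) K(1) L]
  have "(K \<union> L) \<inter> f -` {a} = A"
    using un(2) K(2) assms(2) by (auto simp: set_eq_iff)
  then show "\<exists>K. tube f {a..c} K \<and> K \<inter> f -` {a} = A"
    using un(1) by blast
qed

lemma tubes_extend_interval:
  fixes f :: "'a::t2_space \<Rightarrow> real"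
  assumes f: "continuous_on UNIV f" and "a \<le> b"
    and "\<And>x. a \<le> x \<Longrightarrow> x \<le> b \<Longrightarrow> transport_near f x"
  shows "tubes_extend f a b"
  using assms(2)
proof (induction rule: Bolzano)
  case (trans a b c)
  then show ?case
    using tubes_extend_trans[OF f, of a b c] by simp
next
  case (local x)
  then show ?case
    using tubes_extend_locally[OF assms(3)] by simp
qed

text \<open>The tube over \<open>{t..}\<close> is the union of tubes over \<open>{t..t + n}\<close>, each chosen as an extension of the
  one before it.\<close>

lemma tube_over_half_line:
  fixes f :: "'a::t2_space \<Rightarrow> real"
  assumes f: "continuous_on UNIV f" and A: "tube f {t} A"
    and triv: "\<And>x. t \<le> x \<Longrightarrow> transport_near f x"
  obtains K where "closed K" "openin (top_of_set (f -` {t..})) K" "f ` K = {t..}"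
    "K \<inter> f -` {t} = A" "\<And>s. compact (K \<inter> f -` {..s})"
proof -
  define I where "I n = {t..t + real n}" for n
  have base: "tube f (I 0) A"
    using A unfolding I_def by simp
  have step: "\<exists>K'. tube f (I (Suc n)) K' \<and> K' \<inter> f -` I n = K" if K: "tube f (I n) K" for n K
  proof -
    define b c where "b = t + real n" and "c = t + real (Suc n)"
    have bc: "t \<le> b" "b \<le> c" and I: "I n = {t..b}" "I (Suc n) = {t..c}"
      unfolding b_def c_def I_def by auto
    have "tube f {b} (K \<inter> f -` {b})"
      using bc by (intro tube_fibre[OF f K]) (auto simp: I)
    moreover have "tubes_extend f b c"
      using bc triv by (intro tubes_extend_interval[OF f]) auto
    ultimately obtain L where "tube f {b..c} L" "L \<inter> f -` {b} = K \<inter> f -` {b}"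
      unfolding tubes_extend_def by blast
    then show ?thesis
      using tube_union[OF f bc, of K L] K unfolding I by auto
  qed
  have "\<exists>T. \<forall>n. (tube f (I n) (T n) \<and> (n = 0 \<longrightarrow> T n = A)) \<and> T (Suc n) \<inter> f -` I n = T n"
    by (rule dependent_nat_choice) (use base step in auto)
  then obtain T where T: "\<And>n. tube f (I n) (T n)" "T 0 = A" "\<And>n. T (Suc n) \<inter> f -` I n = T n"
    by metis
  have T_mono: "T m \<subseteq> T n" if "m \<le> n" for m n
  proof (rule lift_Suc_mono_le[OF _ that])
    show "T i \<subseteq> T (Suc i)" for i
      using T(3)[of i] by blast
  qed
  have I_mono: "I m \<subseteq> I n" if "m \<le> n" for m n
    using that unfolding I_def by auto
  have T_f: "f p \<in> I n" if "p \<in> T n" for p n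
    using T(1)[of n] that unfolding tube_def by blast
  have T_stable: "p \<in> T n" if "p \<in> T (n + k)" "f p \<in> I n" for p n k
    using that
  proof (induction k)
    case (Suc k)
    have "f p \<in> I (n + k)"
      using Suc.prems(2) I_mono[of n "n + k"] by auto
    then show ?case
      using Suc T(3)[of "n + k"] by auto
  qed simp
  define K where "K = (\<Union>n. T n)"
  have K_T: "p \<in> K \<longleftrightarrow> p \<in> T n" if "f p \<in> I n" for p n
  proof
    assume "p \<in> K"
    then obtain m where "p \<in> T m"
      unfolding K_def by blast
    then have "p \<in> T (n + m)"
      using T_mono[of m "n + m"] by auto
    then show "p \<in> T n"
      using T_stable that by blast
  qed (auto simp: K_def)
  have K_ge: "t \<le> f p" if "p \<in> K" for p
    using that T_f unfolding K_def I_def by fastforce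
  have large: "\<exists>n. s < t + real n" for s
    using reals_Archimedean2[of "s - t"] by (auto simp: algebra_simps)
  have K_below: "K \<inter> f -` {..s} = T n \<inter> f -` {..s}" if "s < t + real n" for s n
  proof (intro set_eqI)
    fix p
    show "p \<in> K \<inter> f -` {..s} \<longleftrightarrow> p \<in> T n \<inter> f -` {..s}"
      using K_T[of p n] K_ge[of p] T_f[of p n] that unfolding I_def by auto
  qed
  have cpt: "compact (K \<inter> f -` {..s})" for s
  proof -
    obtain n where "s < t + real n"
      using large by blast
    moreover have "closed (f -` {..s})"
      using f by (simp add: closed_vimage)
    ultimately show ?thesis
      using K_below T(1)[of n] unfolding tube_def by (simp add: compact_Int_closed)
  qed
  have lt: "open (f -` {..<s})" for s
    using f by (simp add: open_vimage)
  have "closed K"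
    unfolding closed_def open_subopen[of "- K"]
  proof
    fix p assume p: "p \<in> - K"
    obtain n where n: "f p < t + real n"
      using large by blast
    let ?U = "f -` {..<t + real n} - T n"
    have "open ?U"
      using lt T(1)[of n] unfolding tube_def by (auto intro: open_Diff compact_imp_closed)
    moreover have "p \<in> ?U"
      using p n unfolding K_def by auto
    moreover have "?U \<subseteq> - K"
    proof
      fix q assume "q \<in> ?U"
      then show "q \<in> - K"
        using K_T[of q n] K_ge[of q] unfolding I_def by auto
    qed
    ultimately show "\<exists>V. open V \<and> p \<in> V \<and> V \<subseteq> - K"
      by blast
  qed
  moreover have "openin (top_of_set (f -` {t..})) K"
    unfolding openin_subopen[of _ K]
  proof
    fix p assume p: "p \<in> K"
    obtain n where n: "f p < t + real n"
      using large by blast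
    obtain U where U: "open U" "T n = f -` I n \<inter> U"
      using T(1)[of n] unfolding tube_def openin_open by blast
    let ?V = "f -` {t..} \<inter> (U \<inter> f -` {..<t + real n})"
    have "openin (top_of_set (f -` {t..})) ?V"
      using U(1) lt by (intro openin_open_Int) auto
    moreover have "p \<in> ?V"
      using p n K_ge[OF p] K_T[of p n] U(2) unfolding I_def by auto
    moreover have "?V \<subseteq> K"
      using U(2) unfolding K_def I_def by fastforce
    ultimately show "\<exists>V. openin (top_of_set (f -` {t..})) V \<and> p \<in> V \<and> V \<subseteq> K"
      by blast
  qed
  moreover have "f ` K = {t..}"
  proof
    show "f ` K \<subseteq> {t..}"
      using K_ge by auto
    show "{t..} \<subseteq> f ` K"
    proof
      fix s assume s: "s \<in> {t..}"
      obtain n where "s < t + real n"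
        using large by blast
      then have "s \<in> f ` T n"
        using s T(1)[of n] unfolding tube_def I_def by auto
      then show "s \<in> f ` K"
        unfolding K_def by blast
    qed
  qed
  moreover have "K \<inter> f -` {t} = A"
  proof (intro set_eqI)
    fix p
    show "p \<in> K \<inter> f -` {t} \<longleftrightarrow> p \<in> A"
      using K_T[of p 0] T_f[of p 0] T(2) unfolding I_def by auto
  qed
  ultimately show ?thesis
    using cpt that by blast
qed

section \<open>A compact fibre part over the unbounded interval\<close>

text \<open>The tube is clopen outside of a ball around \<open>A\<close>, and unbounded, so it contains the complement of
  the ball. The remaining part of \<open>f -` {t..}\<close> is then compact, and open in \<open>f -` {t..}\<close>, so a maximum of \<open>f\<close>
  on it would contradict local triviality.\<close>

lemma compact_open_fibre_part:
  fixes f :: "'a::euclidean_space \<Rightarrow> real"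
  assumes dim: "2 \<le> DIM('a)" and f: "continuous_on UNIV f" and A: "tube f {t} A"
    and triv: "\<And>x. t \<le> x \<Longrightarrow> transport_near f x"
  shows "f -` {t} = A" "compact (f -` {..s})"
proof -
  obtain K where K: "closed K" "openin (top_of_set (f -` {t..})) K" "f ` K = {t..}"
    "K \<inter> f -` {t} = A" "\<And>s. compact (K \<inter> f -` {..s})"
    using tube_over_half_line[OF f A triv] by blast
  obtain U where U: "open U" "K = f -` {t..} \<inter> U"
    using K(2) unfolding openin_open by blast
  have "bounded A"
    using A compact_imp_bounded unfolding tube_def by blast
  then obtain R where R: "A \<subseteq> cball 0 R"
    by (auto simp: bounded_iff subset_iff)
  let ?B = "cball 0 R :: 'a set"
  have far: "- ?B \<subseteq> K"
  proof -
    have "open (f -` {t<..})"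
      using f by (simp add: open_vimage)
    then have o: "open (U \<inter> f -` {t<..})" "open (- K)"
      using U(1) K(1) by auto
    \<comment> \<open>Outside of the ball \<open>K\<close> avoids the level \<open>t\<close>, where it need not be open in the whole space.\<close>
    have K_out: "p \<in> U \<inter> f -` {t<..}" if "p \<in> K" "p \<notin> ?B" for p
    proof -
      have "f p \<noteq> t"
        using K(4) R that by auto
      then show ?thesis
        using that(1) U(2) by auto
    qed
    \<comment> \<open>In dimension one this complement has two components, of which \<open>K\<close> may contain only one.\<close>
    have conn: "connected (- ?B)"
      by (rule connected_complement_bounded_convex) (use dim in auto)
    have cover: "- ?B \<subseteq> (U \<inter> f -` {t<..}) \<union> - K"
      using K_out by blast
    have disj: "(U \<inter> f -` {t<..}) \<inter> - K \<inter> - ?B = {}"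
      using U(2) by auto
    have "(U \<inter> f -` {t<..}) \<inter> - ?B = {} \<or> - K \<inter> - ?B = {}"
      using connectedD[OF conn o disj cover] .
    moreover have "(U \<inter> f -` {t<..}) \<inter> - ?B \<noteq> {}"
    proof
      assume empty: "(U \<inter> f -` {t<..}) \<inter> - ?B = {}"
      then have "K \<subseteq> ?B"
        using K_out by blast
      then have "f ` K \<subseteq> f ` ?B"
        by blast
      moreover have "bounded (f ` ?B)"
        by (intro compact_imp_bounded compact_continuous_image continuous_on_subset[OF f]) auto
      ultimately have "bounded {t..}"
        using K(3) bounded_subset by metis
      then have "bdd_above {t..}"
        by (rule bounded_imp_bdd_above)
      then obtain M where "\<And>x. t \<le> x \<Longrightarrow> x \<le> M"
        unfolding bdd_above_def by auto
      from this[of "max t (M + 1)"] show False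
        by simp
    qed
    ultimately show ?thesis
      by blast
  qed
  show "compact (f -` {..s})"
  proof -
    have "f -` {..s} \<subseteq> (K \<inter> f -` {..s}) \<union> ?B"
      using far by blast
    then have "bounded (f -` {..s})"
      using K(5) by (meson bounded_Un bounded_cball bounded_subset compact_imp_bounded)
    moreover have "closed (f -` {..s})"
      using f by (simp add: closed_vimage)
    ultimately show ?thesis
      by (simp add: compact_eq_bounded_closed)
  qed
  have "f -` {t..} - K = {}"
  proof (rule ccontr)
    let ?W = "f -` {t..} - K"
    assume ne: "?W \<noteq> {}"
    have "?W = f -` {t..} \<inter> - U"
      using U(2) by blast
    moreover have "closed (f -` {t..} \<inter> - U)"
      using f U(1) by (intro closed_Int) (auto simp: closed_vimage)
    ultimately have "closed ?W"
      by simp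
    moreover have "bounded ?W"
      using far by (intro bounded_subset[OF bounded_cball[of 0 R]]) blast
    ultimately have "compact ?W"
      by (simp add: compact_eq_bounded_closed)
    then obtain q where q: "q \<in> ?W" "\<And>p. p \<in> ?W \<Longrightarrow> f p \<le> f q"
      using continuous_attains_sup[OF _ ne continuous_on_subset[OF f]] by blast
    then have "t \<le> f q"
      by simp
    then obtain p where "p \<in> - K" "f p > f q"
      using transport_near_imp_larger_value[OF triv, of q "- K"] K(1) q(1) by auto
    then show False
      using q(2)[of p] \<open>t \<le> f q\<close> by auto
  qed
  then show "f -` {t} = A"
    using K(4) by auto
qed

text \<open>By the Sura-Bura theorem a compact component is the intersection of the compact open parts of the
  fibre that contain it, and each of these is the whole fibre. Compact sublevel sets give a minimum
  of \<open>f\<close>. It is recorded together with the failure of transport for \<open>-f\<close>, which shows that the minimal value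
  is atypical.\<close>

lemma compact_fibre_component:
  fixes f :: "'a::euclidean_space \<Rightarrow> real"
  assumes dim: "2 \<le> DIM('a)" and f: "continuous_on UNIV f"
    and C: "C \<in> components (f -` {t})" "compact C"
    and triv: "\<And>x. t \<le> x \<Longrightarrow> transport_near f x"
  shows "f -` {t} = C" "compact (f -` {s})"
    "\<exists>p. (\<forall>q. f p \<le> f q) \<and> \<not> transport_near (\<lambda>p. - f p) (- f p)"
proof -
  have "closed (f -` {t})"
    using f by (simp add: closed_vimage)
  then have "locally compact (f -` {t})"
    by (rule closed_imp_locally_compact)
  from Sura_Bura[OF this C]
  have C_eq: "C = \<Inter>{A. C \<subseteq> A \<and> compact A \<and> openin (top_of_set (f -` {t})) A}"
    by simp
  have part: "tube f {t} A" if "C \<subseteq> A" "compact A" "openin (top_of_set (f -` {t})) A" for A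
  proof -
    have "A \<noteq> {}" "A \<subseteq> f -` {t}"
      using that in_components_nonempty[OF C(1)] openin_imp_subset by blast+
    then have "f ` A = {t}"
      by auto
    then show ?thesis
      using that unfolding tube_def by blast
  qed
  have "f -` {t} \<subseteq> C"
    using compact_open_fibre_part(1)[OF dim f part triv] by (subst C_eq) blast
  then show fibre: "f -` {t} = C"
    using in_components_subset[OF C(1)] by blast
  have "tube f {t} (f -` {t})"
    using fibre C(2) by (intro part) auto
  note sublevel = compact_open_fibre_part(2)[OF dim f this triv]
  have "closed (f -` {s})"
    using f by (simp add: closed_vimage)
  then have "compact (f -` {..s} \<inter> f -` {s})"
    using sublevel by (intro compact_Int_closed)
  moreover have "f -` {..s} \<inter> f -` {s} = f -` {s}"
    by auto
  ultimately show "compact (f -` {s})"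
    by simp
  have "f -` {..t} \<noteq> {}"
    using in_components_nonempty[OF C(1)] fibre by force
  then obtain p where p: "f p \<le> t" "\<And>q. f q \<le> t \<Longrightarrow> f p \<le> f q"
    using continuous_attains_inf[OF sublevel _ continuous_on_subset[OF f]] by fastforce
  then have min: "f p \<le> f q" for q
    by (metis linear order_trans)
  then have "\<not> transport_near (\<lambda>p. - f p) (- f p)"
    using transport_near_imp_larger_value[of "\<lambda>p. - f p" p UNIV] min
    by (auto simp flip: not_le)
  then show "\<exists>p. (\<forall>q. f p \<le> f q) \<and> \<not> transport_near (\<lambda>p. - f p) (- f p)"
    using min by blast
qed

lemma continuous_on_polynomial_of_degree:
  assumes "polynomial_of_degree d f"
  shows "continuous_on UNIV f"
proof -
  obtain a where "\<And>x y. f (x, y) = (\<Sum>i\<le>d. \<Sum>j\<le>d - i. a i j * x ^ i * y ^ j)"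
    using assms unfolding polynomial_of_degree_def by blast
  then have "f = (\<lambda>z. \<Sum>i\<le>d. \<Sum>j\<le>d - i. a i j * fst z ^ i * snd z ^ j)"
    by (auto simp: fun_eq_iff)
  then show ?thesis
    by (simp only:) (intro continuous_intros)
qed

theorem lemma2p2:
  fixes f :: "real \<times> real \<Rightarrow> real" and d :: nat
  assumes "polynomial_of_degree d f" and "d \<ge> 2"
  shows "(\<forall>t\<in>I_plus f. \<forall>C\<in>components (f -` {t}). compact C \<longrightarrow>
            f -` {t} = C \<and> (\<forall>s\<in>I_minus f. f -` {s} = {}) \<and>
            (\<forall>s. f -` {s} \<noteq> {} \<longrightarrow> compact (f -` {s})))
       \<and> (\<forall>t\<in>I_minus f. \<forall>C\<in>components (f -` {t}). compact C \<longrightarrow>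
            f -` {t} = C \<and> (\<forall>s\<in>I_plus f. f -` {s} = {}) \<and>
            (\<forall>s. f -` {s} \<noteq> {} \<longrightarrow> compact (f -` {s})))"
proof (intro conjI ballI impI)
  let ?g = "\<lambda>p. - f p"
  have f: "continuous_on UNIV f" "continuous_on UNIV ?g"
    using continuous_on_polynomial_of_degree[OF assms(1)] by (auto intro: continuous_on_minus)
  have dim: "2 \<le> DIM(real \<times> real)"
    by simp
  have fibre_neg: "?g -` {- s} = f -` {s}" for s
    by auto
  have plus: "transport_near f x" if "t \<in> I_plus f" "t \<le> x" for t x
    using that unfolding I_plus_def by (intro transport_near_typical_value) auto
  have minus: "transport_near f x" if "t \<in> I_minus f" "x \<le> t" for t x
    using that unfolding I_minus_def by (intro transport_near_typical_value) auto
  have minus': "transport_near ?g x" if "t \<in> I_minus f" "- t \<le> x" for t x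
    using transport_near_uminus[OF minus[OF that(1), of "- x"]] that(2) by simp
  {
    fix t C assume t: "t \<in> I_plus f" and C: "C \<in> components (f -` {t})" "compact C"
    note main = compact_fibre_component[OF dim f(1) C plus[OF t]]
    show "f -` {t} = C" "\<forall>s. f -` {s} \<noteq> {} \<longrightarrow> compact (f -` {s})"
      using main(1,2) by auto
    obtain p where p: "\<And>q. f p \<le> f q" "\<not> transport_near ?g (- f p)"
      using main(3) by blast
    fix s assume s: "s \<in> I_minus f"
    then have "s < f p"
      using p(2) minus'[OF s, of "- f p"] by force
    then have "f q \<noteq> s" for q
      using p(1)[of q] by simp
    then show "f -` {s} = {}"
      by blast
  next
    fix t C assume t: "t \<in> I_minus f" and C: "C \<in> components (f -` {t})" "compact C"
    have C': "C \<in> components (?g -` {- t})"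
      using C(1) fibre_neg by simp
    note main = compact_fibre_component[OF dim f(2) C' C(2) minus'[OF t]]
    show "f -` {t} = C" "\<forall>s. f -` {s} \<noteq> {} \<longrightarrow> compact (f -` {s})"
      using main(1) main(2)[of "- _"] fibre_neg by auto
    obtain p where p: "\<And>q. f q \<le> f p" "\<not> transport_near f (f p)"
      using main(3) by auto
    fix s assume s: "s \<in> I_plus f"
    then have "f p < s"
      using p(2) plus[OF s, of "f p"] by force
    then have "f q \<noteq> s" for q
      using p(1)[of q] by simp
    then show "f -` {s} = {}"
      by blast
  }
qed

end
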